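(* Let $\mathcal A$ be a Boolean algebra, let $(x_\alpha)$ be a net in $\mathcal A$ and let $x\in\mathcal A$. Then $(x_\alpha)$ converges in order to $x$ if and only if for every $u\in\mathcal A$ with $u>0$ there exist $v\in\mathcal A$ with $0<v\leqslant u$ and an index $\alpha_0$ such that $x_\alpha\wedge v=x\wedge v$ for all $\alpha\geqslant\alpha_0$.
   Context: In a partially ordered set, a net $(x_\alpha)$ converges in order to $x$ if there exist non-empty sets $A$ and $B$ such that $\sup A=x=\inf B$ and for every $a\in A$ and $b\in B$ the order interval $[a,b]$ contains a tail of the net, i.e., there is $\alpha_0$ with $a\leqslant x_\alpha\leqslant b$ for all $\alpha\geqslant\alpha_0$. *)

theory Defs
  imports Main "HOL-Library.Lub_Glb"
begin

text \<open>
  Index sets of nets are upward directed, nonempty preorders; antisymmetry is not required.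
  The carrier and the relation are explicit, where \<^term>\<open>(i, j) \<in> r\<close> means that
  \<open>i\<close> is below \<open>j\<close>. A net indexed by \<open>I\<close> is a function of which only the values on \<open>I\<close> matter.
\<close>

definition directed_preorder_on :: "'i set \<Rightarrow> 'i rel \<Rightarrow> bool" where
  "directed_preorder_on I r \<longleftrightarrow>
     I \<noteq> {} \<and> preorder_on I r \<and> (\<forall>i\<in>I. \<forall>j\<in>I. \<exists>k\<in>I. (i, k) \<in> r \<and> (j, k) \<in> r)"

definition converges_in_order :: "'i set \<Rightarrow> 'i rel \<Rightarrow> ('i \<Rightarrow> 'a::order) \<Rightarrow> 'a \<Rightarrow> bool" where
  "converges_in_order I r X x \<longleftrightarrow>
     (\<exists>A B. A \<noteq> {} \<and> B \<noteq> {} \<and> isLub UNIV A x \<and> isGlb UNIV B x \<and>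
       (\<forall>a\<in>A. \<forall>b\<in>B. \<exists>i0\<in>I. \<forall>i\<in>I. (i0, i) \<in> r \<longrightarrow> X i \<in> {a..b}))"

end

theory Submission
  imports Defs
begin

text \<open>
  Call \<open>v\<close> a settling element if the net eventually agrees with \<open>x\<close> below \<open>v\<close>. The condition on
  the right says that the settling elements are order dense: there is one below every nonzero
  element.

  Order convergence gives density because \<open>x\<close> and the tail of the net that lies in \<open>[a, b]\<close> can
  differ only below the gap \<open>b - a\<close>, so that \<open>u - (b - a)\<close> is a settling element. It is nonzero
  for some \<open>a \<in> A\<close> and \<open>b \<in> B\<close>: since \<open>A\<close> has supremum \<open>x\<close> and \<open>B\<close> has infimum \<open>x\<close>, no nonzero
  element lies below all the gaps (\<open>le_all_gaps_imp_bot\<close>).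

  Conversely, if the settling elements \<open>v\<close> are order dense, then \<open>x\<close> is the supremum of the
  elements \<open>x \<sqinter> v\<close> and the infimum of the elements \<open>x \<squnion> - v\<close> (\<open>isLub_inf_order_dense\<close> and
  \<open>isGlb_sup_uminus_order_dense\<close>). These sets witness order convergence, as agreement below \<open>v\<close>
  puts the tail above \<open>x \<sqinter> v\<close>, and agreement below \<open>w\<close> puts it below \<open>x \<squnion> - w\<close>; directedness
  supplies a tail on which both hold.
\<close>

lemma isLub_UNIV_iff:
  "isLub UNIV A x \<longleftrightarrow> (\<forall>a\<in>A. a \<le> x) \<and> (\<forall>y. (\<forall>a\<in>A. a \<le> y) \<longrightarrow> x \<le> y)"
  by (auto simp: isLub_def isUb_def leastP_def setle_def setge_def)

lemma isGlb_UNIV_iff: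
  "isGlb UNIV B x \<longleftrightarrow> (\<forall>b\<in>B. x \<le> b) \<and> (\<forall>y. (\<forall>b\<in>B. y \<le> b) \<longrightarrow> y \<le> x)"
  by (auto simp: isGlb_def isLb_def greatestP_def setle_def setge_def)

definition order_dense :: "'a::boolean_algebra set \<Rightarrow> bool" where
  "order_dense V \<longleftrightarrow> (\<forall>u>bot. \<exists>v\<in>V. bot < v \<and> v \<le> u)"

text \<open>
  If an upper bound \<open>y\<close> of the elements \<open>x \<sqinter> v\<close> were not above \<open>x\<close>, then some nonzero \<open>v \<in> V\<close>
  would lie below \<open>x - y\<close>; but \<open>v = x \<sqinter> v\<close> also lies below \<open>y\<close>.
\<close>

lemma isLub_inf_order_dense:
  fixes x :: "'a::boolean_algebra"
  assumes "order_dense V"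
  shows "isLub UNIV (inf x ` V) x"
proof -
  have "x \<le> y" if ub: "\<And>v. v \<in> V \<Longrightarrow> inf x v \<le> y" for y
  proof (rule ccontr)
    assume "\<not> x \<le> y"
    then have "inf x (- y) \<noteq> bot"
      by (simp add: inf_shunt)
    then obtain v where v: "v \<in> V" "bot < v" "v \<le> inf x (- y)"
      using assms by (auto simp: order_dense_def bot_less)
    then have "v \<le> y"
      using ub[of v] by (simp add: inf_absorb2)
    moreover have "v \<le> - y"
      using v(3) by simp
    ultimately have "v \<le> inf y (- y)"
      by (rule le_infI)
    with \<open>bot < v\<close> show False
      by simp
  qed
  then show ?thesis
    by (auto simp: isLub_UNIV_iff)
qed

text \<open>Complementation turns this into the preceding lemma for \<open>- x\<close>.\<close>

lemma isGlb_sup_uminus_order_dense: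
  fixes x :: "'a::boolean_algebra"
  assumes "order_dense V"
  shows "isGlb UNIV ((\<lambda>v. sup x (- v)) ` V) x"
proof -
  have "y \<le> x" if lb: "\<And>v. v \<in> V \<Longrightarrow> y \<le> sup x (- v)" for y
  proof -
    have "inf (- x) v \<le> - y" if "v \<in> V" for v
      using compl_mono[OF lb[OF that]] by simp
    then have "- x \<le> - y"
      using isLub_inf_order_dense[OF assms, of "- x"] unfolding isLub_UNIV_iff by blast
    then show ?thesis
      by simp
  qed
  then show ?thesis
    by (auto simp: isGlb_UNIV_iff)
qed

text \<open>
  An element below every gap is disjoint from all of \<open>A\<close>, hence from \<open>x\<close>, and is below all of
  \<open>B\<close>, hence below \<open>x\<close>.
\<close>

lemma le_all_gaps_imp_bot:
  fixes x :: "'a::boolean_algebra"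
  assumes "isLub UNIV A x" "isGlb UNIV B x" "A \<noteq> {}" "B \<noteq> {}"
    and le: "\<And>a b. a \<in> A \<Longrightarrow> b \<in> B \<Longrightarrow> u \<le> b - a"
  shows "u = bot"
proof -
  have gap: "u \<le> b \<and> u \<le> - a" if "a \<in> A" "b \<in> B" for a b
    using le[OF that] by (simp add: diff_eq)
  have "u \<le> x"
    using assms gap by (fastforce simp: isGlb_UNIV_iff)
  moreover have "a \<le> - u" if "a \<in> A" for a
    using gap[OF that] \<open>B \<noteq> {}\<close> compl_le_swap1 by blast
  then have "x \<le> - u"
    using assms by (simp add: isLub_UNIV_iff)
  ultimately have "u \<le> - u"
    by (rule order_trans)
  then show ?thesis
    using inf_shunt[of u u] by simp
qed

text \<open>
  An element \<open>v\<close> disjoint from \<open>b - a\<close> meets \<open>b\<close> only inside \<open>a\<close>, so every element of \<open>[a, b]\<close>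
  has the same meet with \<open>v\<close> as \<open>a\<close>.
\<close>

lemma inf_eq_outside_gap:
  fixes x y :: "'a::boolean_algebra"
  assumes "x \<in> {a..b}" "y \<in> {a..b}" "inf v (b - a) = bot"
  shows "inf y v = inf x v"
proof -
  have below: "inf s v \<le> inf t v" if "s \<le> b" "a \<le> t" for s t
  proof -
    have "inf (inf v b) (- a) = bot"
      using assms(3) by (simp add: diff_eq inf_assoc)
    then have "inf v b \<le> a"
      by (simp add: inf_shunt)
    moreover have "inf s v \<le> inf v b"
      using \<open>s \<le> b\<close> by (simp add: le_infI1)
    ultimately show ?thesis
      using \<open>a \<le> t\<close> by (meson inf.bounded_iff inf_le2 order_trans)
  qed
  show ?thesis
    using assms below by (auto intro: order.antisym)
qed

lemma inf_eq_imp_bounds: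
  fixes x y :: "'a::boolean_algebra"
  assumes "inf y v = inf x v"
  shows "inf x v \<le> y" "y \<le> sup x (- v)"
proof -
  show "inf x v \<le> y"
    by (metis assms inf_le1)
  have "inf y v \<le> x"
    using assms by simp
  then show "y \<le> sup x (- v)"
    by (metis inf_commute shunt1 sup_commute)
qed

theorem theorem6p4:
  fixes I :: "'i set" and r :: "'i rel"
    and X :: "'i \<Rightarrow> 'a::boolean_algebra" and x :: 'a
  assumes "directed_preorder_on I r"
  shows "converges_in_order I r X x \<longleftrightarrow>
    (\<forall>u>bot. \<exists>v. bot < v \<and> v \<le> u \<and>
      (\<exists>i0\<in>I. \<forall>i\<in>I. (i0, i) \<in> r \<longrightarrow> inf (X i) v = inf x v))"
proof -
  define V where "V = {v. \<exists>i0\<in>I. \<forall>i\<in>I. (i0, i) \<in> r \<longrightarrow> inf (X i) v = inf x v}"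
  have "converges_in_order I r X x \<longleftrightarrow> order_dense V"
  proof
    assume "converges_in_order I r X x"
    then obtain A B where ne: "A \<noteq> {}" "B \<noteq> {}"
      and lub: "isLub UNIV A x" and glb: "isGlb UNIV B x"
      and tail: "\<And>a b. a \<in> A \<Longrightarrow> b \<in> B \<Longrightarrow> \<exists>i0\<in>I. \<forall>i\<in>I. (i0, i) \<in> r \<longrightarrow> X i \<in> {a..b}"
      unfolding converges_in_order_def by blast
    have "\<exists>v\<in>V. bot < v \<and> v \<le> u" if "bot < u" for u
    proof -
      obtain a b where ab: "a \<in> A" "b \<in> B" "\<not> u \<le> b - a"
        using le_all_gaps_imp_bot[OF lub glb ne] \<open>bot < u\<close> by blast
      define v where "v = inf u (- (b - a))"
      have "v \<noteq> bot"
        using ab(3) by (simp only: v_def inf_shunt double_compl not_False_eq_True)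
      moreover have "inf v (b - a) = bot"
        by (simp add: v_def inf_assoc del: minus_diff_eq)
      moreover have "x \<in> {a..b}"
        using ab lub glb by (simp add: isLub_UNIV_iff isGlb_UNIV_iff)
      ultimately have "v \<in> V"
        using tail[OF ab(1,2)] inf_eq_outside_gap unfolding V_def by blast
      then show ?thesis
        using \<open>v \<noteq> bot\<close> by (auto simp: v_def bot_less)
    qed
    then show "order_dense V"
      by (simp add: order_dense_def)
  next
    assume dense: "order_dense V"
    have "bot \<in> V"
      using assms by (auto simp: V_def directed_preorder_on_def)
    moreover have "\<exists>i0\<in>I. \<forall>i\<in>I. (i0, i) \<in> r \<longrightarrow> X i \<in> {inf x v..sup x (- w)}"
      if "v \<in> V" "w \<in> V" for v w
    proof -
      obtain j k where "j \<in> I" "k \<in> I"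
        and j: "\<And>i. i \<in> I \<Longrightarrow> (j, i) \<in> r \<Longrightarrow> inf (X i) v = inf x v"
        and k: "\<And>i. i \<in> I \<Longrightarrow> (k, i) \<in> r \<Longrightarrow> inf (X i) w = inf x w"
        using \<open>v \<in> V\<close> \<open>w \<in> V\<close> unfolding V_def by blast
      then obtain i0 where "i0 \<in> I" "(j, i0) \<in> r" "(k, i0) \<in> r"
        using assms unfolding directed_preorder_on_def by blast
      moreover have "trans r"
        using assms by (simp add: directed_preorder_on_def preorder_on_def)
      ultimately have "inf (X i) v = inf x v \<and> inf (X i) w = inf x w"
        if "i \<in> I" "(i0, i) \<in> r" for i
        using j k that by (meson transD)
      then show ?thesis
        using \<open>i0 \<in> I\<close> inf_eq_imp_bounds by (metis atLeastAtMost_iff)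
    qed
    ultimately show "converges_in_order I r X x"
      unfolding converges_in_order_def
      using isLub_inf_order_dense[OF dense, of x] isGlb_sup_uminus_order_dense[OF dense, of x]
      by (intro exI[of _ "inf x ` V"] exI[of _ "(\<lambda>v. sup x (- v)) ` V"]) blast
  qed
  then show ?thesis
    unfolding order_dense_def V_def by blast
qed

end
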